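(* Let $\alpha,\beta\ge 0$, and let $\varphi(z)=1+B_1z+B_2z^2+\cdots$ and $\psi(z)=1+D_1z+D_2z^2+\cdots$ be analytic functions on $\mathbb{D}$ with $B_1>0$, $D_1>0$ and $B_2,D_2\in\mathbb{R}$. Let $f(z)=z+\sum_{n=2}^{\infty}a_nz^n$ be bi-univalent in $\mathbb{D}$ and let $g=f^{-1}$. If $f\in\mathcal{P}(\alpha,\varphi)$ and $g\in\mathcal{L}(\beta,\psi)$, then, with $\sigma:=10+36\alpha-7\beta-25\alpha\beta+\beta^2+3\alpha\beta^2$, $$|a_2|\le \frac{B_1D_1\sqrt{2\left[B_1(3-2\beta)+D_1(1+3\alpha)\right]}}{\sqrt{\left|\sigma B_1^2D_1^2-2(1+2\alpha)^2(3-2\beta)(B_2-B_1)D_1^2-2(2-\beta)^2(1+3\alpha)(D_2-D_1)B_1^2\right|}}$$ and $$|\sigma a_3|\le \frac12B_1(\beta^2-11\beta+16)+D_1(1+2\alpha)+\frac12(\beta^2-11\beta+16)|B_2-B_1|+\frac{(2-\beta)^2B_1^2|D_2-D_1|}{D_1^2(1+2\alpha)}.$$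
   Context: $\mathbb{D}=\{z\in\mathbb{C}:|z|<1\}$. $\mathcal{S}$ is the class of univalent (injective) analytic functions $f$ on $\mathbb{D}$ with $f(0)=0$, $f'(0)=1$. By the Koebe one-quarter theorem each $f\in\mathcal{S}$ has an inverse $f^{-1}$ defined at least on $|w|<1/4$. A function $f\in\mathcal{S}$ is bi-univalent in $\mathbb{D}$ if both $f$ and $f^{-1}$ are univalent in $\mathbb{D}$, i.e. the local inverse $f^{-1}$ at $0$ extends to a univalent analytic function on $\mathbb{D}$, still denoted $f^{-1}$. Subordination: for analytic $F,G$ on $\mathbb{D}$, $F(z)\prec G(z)$ means there is an analytic $w:\mathbb{D}\to\mathbb{D}$ with $w(0)=0$ and $F(z)=G(w(z))$ on $\mathbb{D}$. For $\alpha\ge0$ and analytic $\varphi:\mathbb{D}\to\mathbb{C}$, $\varphi(z)=1+B_1z+B_2z^2+\cdots$ with $B_1>0$, $B_2\in\mathbb{R}$, $$\mathcal{P}(\alpha,\varphi):=\left\{f\in\mathcal{S}:\ \frac{zf'(z)}{f(z)}+\alpha\frac{z^2f''(z)}{f(z)}\prec\varphi(z)\right\},$$ $$\mathcal{L}(\alpha,\varphi):=\left\{f\in\mathcal{S}:\ \left(\frac{zf'(z)}{f(z)}\right)^{\alpha}\left(1+\frac{zf''(z)}{f'(z)}\right)^{1-\alpha}\prec\varphi(z)\right\}$$ (quotients are given their limiting values at $z=0$; the powers are the branches equal to $1$ at $z=0$). No univalence or positivity of the real part of $\varphi,\psi$ is assumed.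
   Formalization: The factors 3−2β (first bound) and β²−11β+16 (second bound, twice) are replaced by their absolute values, since the printed bounds fail when these are negative; the first bound is asserted only when its denominator is nonzero. *)

theory Defs
  imports "HOL-Complex_Analysis.Complex_Analysis"
begin

abbreviation unit_disc :: "complex set" where
  "unit_disc \<equiv> ball 0 1"

definition class_S :: "(complex \<Rightarrow> complex) set" where
  "class_S = {f. f holomorphic_on unit_disc \<and> inj_on f unit_disc \<and> f 0 = 0 \<and> deriv f 0 = 1}"

(* g is a univalent analytic function on the disc that extends the germ at 0 of the inverse of f.
   For f in class_S the image of the disc is a neighbourhood of 0, so inv_into is applied
   only to points of that image. *)
definition univalent_inverse :: "(complex \<Rightarrow> complex) \<Rightarrow> (complex \<Rightarrow> complex) \<Rightarrow> bool" where
  "univalent_inverse f g \<longleftrightarrow>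
     g holomorphic_on unit_disc \<and> inj_on g unit_disc \<and>
     (\<forall>\<^sub>F w in nhds 0. g w = inv_into unit_disc f w)"

definition bi_univalent :: "(complex \<Rightarrow> complex) \<Rightarrow> bool" where
  "bi_univalent f \<longleftrightarrow> f \<in> class_S \<and> (\<exists>g. univalent_inverse f g)"

definition subordinate :: "(complex \<Rightarrow> complex) \<Rightarrow> (complex \<Rightarrow> complex) \<Rightarrow> bool" where
  "subordinate F G \<longleftrightarrow>
     F holomorphic_on unit_disc \<and> G holomorphic_on unit_disc \<and>
     (\<exists>w. w holomorphic_on unit_disc \<and> w ` unit_disc \<subseteq> unit_disc \<and> w 0 = 0 \<and>
          (\<forall>z\<in>unit_disc. F z = G (w z)))"

(* The values at 0 in the next two definitions are the limits at 0 of z f'(z) / f(z) and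
   z^2 f''(z) / f(z) for f in class_S. *)
definition quot1 :: "(complex \<Rightarrow> complex) \<Rightarrow> complex \<Rightarrow> complex" where
  "quot1 f z = (if z = 0 then 1 else z * deriv f z / f z)"

definition quot2 :: "(complex \<Rightarrow> complex) \<Rightarrow> complex \<Rightarrow> complex" where
  "quot2 f z = (if z = 0 then 0 else z ^ 2 * deriv (deriv f) z / f z)"

(* h is the branch on the disc of p to the power c with h(0) = 1, for p analytic with p(0) = 1:
   the analytic continuation to the disc of the principal power near 0.  For nonvanishing p
   it is exp (c log p) with log p(0) = 0.  Zeros of p are not excluded outright, so that
   the branch for c = 1 is always p, and for c = 0 it is always 1. *)
definition power_branch ::
    "real \<Rightarrow> (complex \<Rightarrow> complex) \<Rightarrow> (complex \<Rightarrow> complex) \<Rightarrow> bool" where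
  "power_branch c p h \<longleftrightarrow>
     h holomorphic_on unit_disc \<and> h 0 = 1 \<and>
     (\<forall>\<^sub>F z in nhds 0. h z = p z powr complex_of_real c)"

definition class_P :: "real \<Rightarrow> (complex \<Rightarrow> complex) \<Rightarrow> (complex \<Rightarrow> complex) set" where
  "class_P \<alpha> \<phi> =
     {f \<in> class_S. subordinate (\<lambda>z. quot1 f z + complex_of_real \<alpha> * quot2 f z) \<phi>}"

definition class_L :: "real \<Rightarrow> (complex \<Rightarrow> complex) \<Rightarrow> (complex \<Rightarrow> complex) set" where
  "class_L \<alpha> \<phi> =
     {f \<in> class_S. \<exists>u v. power_branch \<alpha> (quot1 f) u \<and>
        power_branch (1 - \<alpha>) (\<lambda>z. 1 + z * deriv (deriv f) z / deriv f z) v \<and>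
        subordinate (\<lambda>z. u z * v z) \<phi>}"

abbreviation taylor_coeff :: "(complex \<Rightarrow> complex) \<Rightarrow> nat \<Rightarrow> complex" where
  "taylor_coeff f n \<equiv> fps_nth (fps_expansion f 0) n"

end

theory Submission imports Defs
begin

text \<open>
  Write the two subordinations with Schwarz functions u and v and compare the coefficients of
  z and z^2 on both sides; since g inverts f, this gives four equations between
  a2, a3 and the first two coefficients of u and v. Apart from one term quadratic in the first
  coefficient, the second coefficients enter only through u2 + u1^2 and v2 + v1^2, which lie in
  the closed unit disc by Schwarz--Pick. Eliminating a3 from the two equations of order 2
  bounds a2, and eliminating a2^2 bounds a3.
\<close>

section \<open>Coefficients of Schwarz functions, composites and subordinate functions\<close>

text \<open>Factor w(z) = z h(z). The two coefficients are then h(0) and h'(0), and the second bound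
  is Schwarz-Pick for h at the origin: follow h by the disc automorphism that sends h(0) to 0 and
  apply the Schwarz lemma to the result.\<close>

lemma Schwarz_second_coeff:
  assumes w: "w holomorphic_on ball 0 1" "w ` ball 0 1 \<subseteq> ball 0 1" "w 0 = 0"
    and W: "w has_fps_expansion W"
  shows "cmod (fps_nth W 1) \<le> 1" "cmod (fps_nth W 2) \<le> 1 - (cmod (fps_nth W 1))\<^sup>2"
proof -
  have no: "cmod (w z) < 1" if "cmod z < 1" for z
    using w(2) that by (auto simp: image_subset_iff)
  obtain h where h: "h holomorphic_on ball 0 1" "\<And>z. cmod z < 1 \<Longrightarrow> w z = z * h z"
      "deriv w 0 = h 0"
    using Schwarz3[OF w(1,3)] by blast
  define H where "H = fps_expansion h 0"
  have H: "h has_fps_expansion H"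
    unfolding H_def by (rule has_fps_expansion_fps_expansion[OF _ _ h(1)]) auto
  have "(\<lambda>z. z * h z) has_fps_expansion fps_X * H"
    by (intro fps_expansion_intros H)
  also have "?this \<longleftrightarrow> w has_fps_expansion fps_X * H"
  proof (rule has_fps_expansion_cong)
    have "\<forall>\<^sub>F z in nhds 0. z \<in> ball (0::complex) 1"
      by (rule eventually_nhds_in_open) auto
    then show "\<forall>\<^sub>F z in nhds 0. z * h z = w z"
      by eventually_elim (simp add: h(2))
  qed simp
  finally have "W = fps_X * H"
    using W fps_expansion_unique_complex by blast
  then have W1: "fps_nth W 1 = h 0" and W2: "fps_nth W 2 = deriv h 0"
    using has_fps_expansion_imp_0_eq_fps_nth_0[OF H]
      has_fps_expansion_imp_0_eq_fps_nth_0[OF has_fps_expansion_deriv[OF H]]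
    by simp_all
  have h0: "cmod (h 0) \<le> 1"
    using Schwarz_Lemma(2)[OF w(1,3) no, of 0] h(3) by simp
  then show "cmod (fps_nth W 1) \<le> 1"
    by (simp only: W1)
  have "cmod (deriv h 0) \<le> 1 - (cmod (h 0))\<^sup>2"
  \<comment> \<open>Linear w is split off because h is then constant, possibly of modulus 1. For
    every other w the equality case of the Schwarz lemma gives |h| < 1 on the whole disc, so that
    the automorphism can be applied to h.\<close>
  proof (cases "\<exists>a. \<forall>z. cmod z < 1 \<longrightarrow> w z = a * z")
    case True
    then obtain a where a: "\<And>z. cmod z < 1 \<Longrightarrow> w z = a * z" by blast
    have "h z = a" if "z \<in> ball 0 1 - {0}" for z
      using a[of z] h(2)[of z] that by auto
    then have "\<forall>\<^sub>F z in at 0. h z = a"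
      unfolding eventually_at by (intro exI[of _ 1]) auto
    \<comment> \<open>The relation \<open>w z = z * h z\<close> does not determine h at 0; its value
      there comes from continuity.\<close>
    moreover have "(h \<longlongrightarrow> h 0) (at 0)"
      using holomorphic_on_imp_continuous_on[OF h(1)]
      by (simp add: continuous_on_eq_continuous_at continuous_at)
    ultimately have "h 0 = a"
      using tendsto_eventually tendsto_unique trivial_limit_at by metis
    with \<open>\<And>z. z \<in> ball 0 1 - {0} \<Longrightarrow> h z = a\<close>
    have "h z = a" if "z \<in> ball 0 1" for z
      using that by (cases "z = 0") auto
    moreover have "\<forall>\<^sub>F z in nhds 0. z \<in> ball (0::complex) 1"
      by (rule eventually_nhds_in_open) auto
    ultimately have "\<forall>\<^sub>F z in nhds 0. h z = a"
      by (auto elim: eventually_mono)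
    then have "deriv h 0 = 0"
      by (subst deriv_cong_ev[where g = "\<lambda>_. a"]) auto
    then show ?thesis
      using h0 by (simp add: power_le_one)
  next
    case False
    have lt: "cmod (h z) < 1" if "cmod z < 1" for z
    proof (cases "z = 0")
      case True
      then show ?thesis
        using Schwarz_Lemma(3)[OF w(1,3) no, of 0] False h0 h(3)
        by (metis norm_zero order_le_less zero_less_one)
    next
      case z: False
      have "cmod (w z) \<le> cmod z"
        using Schwarz_Lemma(1)[OF w(1,3) no that] by blast
      moreover have "cmod (w z) \<noteq> cmod z"
        using Schwarz_Lemma(3)[OF w(1,3) no, of 0] False z that
        by (metis norm_zero zero_less_one)
      ultimately show ?thesis
        using h(2)[OF that] z by (simp add: norm_mult)
    qed
    define c where "c = h 0"
    have c: "cmod c < 1" using lt[of 0] by (simp add: c_def)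
    \<comment> \<open>The argument 0 is the rotation angle, so m = (h - c) / (1 - cnj c * h). As
      h(0) = c, the quotient rule at 0 leaves m'(0) = h'(0) / (1 - |c|^2).\<close>
    define m where "m z = Moebius_function 0 c (h z)" for z
    have "m holomorphic_on ball 0 1"
      using holomorphic_on_compose_gen[OF h(1) Moebius_function_holomorphic[OF c, of 0]] lt
      unfolding m_def o_def by (auto simp: image_subset_iff)
    moreover have "m 0 = 0"
      by (simp add: m_def c_def Moebius_function_def)
    moreover have "cmod (m z) < 1" if "cmod z < 1" for z
      unfolding m_def by (rule Moebius_function_norm_lt_1[OF c lt[OF that]])
    ultimately have "cmod (deriv m 0) \<le> 1"
      by (rule Schwarz_Lemma(2)[of m 0]) auto
    have pos: "1 - (cmod c)\<^sup>2 > 0"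
      using c by (simp add: power_less_one_iff abs_square_less_1)
    have cc: "1 - cnj c * c = complex_of_real (1 - (cmod c)\<^sup>2)"
      using complex_norm_square[of c] by (simp add: mult.commute)
    have nz: "1 - cnj c * c \<noteq> 0"
      unfolding cc of_real_eq_0_iff using pos by linarith
    have "(h has_field_derivative deriv h 0) (at 0)"
      by (rule holomorphic_derivI[OF h(1)]) auto
    then have "(m has_field_derivative
        (deriv h 0 * (1 - cnj c * h 0) - (h 0 - c) * (- (cnj c * deriv h 0))) /
        ((1 - cnj c * h 0) * (1 - cnj c * h 0))) (at 0)"
      unfolding m_def Moebius_function_def
      using nz by (auto intro!: derivative_eq_intros simp: c_def)
    then have "deriv m 0 = deriv h 0 / (1 - cnj c * c)"
      using nz by (simp add: DERIV_imp_deriv c_def)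
    then have "cmod (deriv m 0) = cmod (deriv h 0) / \<bar>1 - (cmod c)\<^sup>2\<bar>"
      by (simp only: cc norm_divide norm_of_real)
    then show ?thesis
      using \<open>cmod (deriv m 0) \<le> 1\<close> pos by (simp add: c_def)
  qed
  then show "cmod (fps_nth W 2) \<le> 1 - (cmod (fps_nth W 1))\<^sup>2"
    by (simp only: W1 W2)
qed

lemma fps_compose_nth_1:
  "fps_nth (F oo G) 1 = fps_nth F 1 * fps_nth G 1"
  by (simp add: fps_compose_nth)

lemma fps_compose_nth_2:
  assumes "fps_nth G 0 = 0"
  shows "fps_nth (F oo G) 2 = fps_nth F 1 * fps_nth G 2 + fps_nth F 2 * (fps_nth G 1)\<^sup>2"
  using assms
  by (simp add: fps_compose_nth eval_nat_numeral fps_mult_nth)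

lemma fps_compose_nth_3:
  fixes F G :: "'a::comm_ring_1 fps"
  assumes "fps_nth G 0 = 0"
  shows "fps_nth (F oo G) 3 = fps_nth F 1 * fps_nth G 3
    + 2 * fps_nth F 2 * fps_nth G 1 * fps_nth G 2 + fps_nth F 3 * fps_nth G 1 ^ 3"
  using assms
  by (simp add: fps_compose_nth eval_nat_numeral fps_mult_nth algebra_simps)

text \<open>Let w1, w2 be the coefficients of the Schwarz function, c = w1 and x = w2 + w1^2. The
  bound |w2| <= 1 - |w1|^2 is exactly what gives |x| <= 1. Replacing w2 by x - c^2 in the second
  coefficient of the composite produces the difference of the first two coefficients of
  \<open>GG\<close>, hence the B2 - B1 and D2 - D1 of the final bounds.\<close>

lemma subordinate_coeffs:
  assumes "subordinate F G"
    and F: "F has_fps_expansion FF" and G: "G has_fps_expansion GG"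
  obtains c x where "cmod c \<le> 1" "cmod x \<le> 1"
    "fps_nth FF 1 = fps_nth GG 1 * c"
    "fps_nth FF 2 = fps_nth GG 1 * x + (fps_nth GG 2 - fps_nth GG 1) * c\<^sup>2"
proof -
  obtain w where w: "w holomorphic_on ball 0 1" "w ` ball 0 1 \<subseteq> ball 0 1" "w 0 = 0"
      "\<And>z. z \<in> ball 0 1 \<Longrightarrow> F z = G (w z)"
    using assms(1) unfolding subordinate_def by blast
  define W where "W = fps_expansion w 0"
  have W: "w has_fps_expansion W"
    unfolding W_def by (rule has_fps_expansion_fps_expansion[OF _ _ w(1)]) auto
  have W0: "fps_nth W 0 = 0"
    using has_fps_expansion_imp_0_eq_fps_nth_0[OF W] w(3) by simp
  have "(G \<circ> w) has_fps_expansion (GG oo W)"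
    by (rule has_fps_expansion_compose[OF G W W0])
  also have "?this \<longleftrightarrow> F has_fps_expansion (GG oo W)"
  proof (rule has_fps_expansion_cong)
    have "\<forall>\<^sub>F z in nhds 0. z \<in> ball (0::complex) 1"
      by (rule eventually_nhds_in_open) auto
    then show "\<forall>\<^sub>F z in nhds 0. (G \<circ> w) z = F z"
      by eventually_elim (simp add: w(4))
  qed simp
  finally have FF: "FF = GG oo W"
    using F fps_expansion_unique_complex by blast
  define c where "c = fps_nth W 1"
  define x where "x = fps_nth W 2 + c\<^sup>2"
  note bd = Schwarz_second_coeff[OF w(1-3) W]
  have "cmod x \<le> cmod (fps_nth W 2) + (cmod c)\<^sup>2"
    unfolding x_def by (metis norm_power norm_triangle_ineq)
  then have "cmod x \<le> 1"
    using bd(2) by (simp add: c_def)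
  moreover have "fps_nth FF 1 = fps_nth GG 1 * c"
    unfolding FF c_def by (rule fps_compose_nth_1)
  moreover have "fps_nth FF 2 = fps_nth GG 1 * x + (fps_nth GG 2 - fps_nth GG 1) * c\<^sup>2"
    unfolding FF fps_compose_nth_2[OF W0] x_def c_def by (simp add: algebra_simps)
  ultimately show ?thesis
    using that bd(1) unfolding c_def by blast
qed

section \<open>Coefficients of normalized univalent functions and of their inverses\<close>

lemma class_S_fps_expansion:
  assumes "f \<in> class_S"
  shows "f has_fps_expansion fps_expansion f 0" "taylor_coeff f 0 = 0" "taylor_coeff f 1 = 1"
proof -
  show *: "f has_fps_expansion fps_expansion f 0"
    using assms has_fps_expansion_fps_expansion[of "ball 0 1" f] by (auto simp: class_S_def)
  show "taylor_coeff f 0 = 0"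
    using assms has_fps_expansion_imp_0_eq_fps_nth_0[OF *] by (simp add: class_S_def)
  show "taylor_coeff f 1 = 1"
    using assms has_fps_expansion_imp_0_eq_fps_nth_0[OF has_fps_expansion_deriv[OF *]]
    by (simp add: class_S_def)
qed

lemma class_S_nonzero:
  assumes "f \<in> class_S" "z \<in> ball 0 1" "z \<noteq> 0"
  shows "f z \<noteq> 0"
  using assms unfolding class_S_def inj_on_def
  by (metis (mono_tags, lifting) centre_in_ball mem_Collect_eq zero_less_one)

text \<open>Near 0 the composite of f and g is the identity, so the coefficients of z^2 and z^3 in
  \<open>GG oo FF\<close> vanish; they are solved in turn for those of g.\<close>

lemma inverse_taylor_coeffs:
  assumes f: "f \<in> class_S" and g: "g \<in> class_S" and fg: "univalent_inverse f g"
  shows "taylor_coeff g 2 = - taylor_coeff f 2"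
    and "taylor_coeff g 3 = 2 * (taylor_coeff f 2)\<^sup>2 - taylor_coeff f 3"
proof -
  note F = class_S_fps_expansion[OF f] and G = class_S_fps_expansion[OF g]
  define FF GG where "FF = fps_expansion f 0" and "GG = fps_expansion g 0"
  \<comment> \<open>The germ of g agrees with the inverse only for w near 0; continuity of f at 0
    allows w = f z there.\<close>
  have "(f \<longlongrightarrow> 0) (nhds 0)"
    using has_fps_expansion_imp_continuous[OF F(1), of UNIV] f
    by (simp add: class_S_def continuous_at tendsto_nhds_iff)
  then have "\<forall>\<^sub>F z in nhds 0. g (f z) = inv_into unit_disc f (f z)"
    using fg unfolding univalent_inverse_def filterlim_iff by blast
  moreover have "\<forall>\<^sub>F z in nhds 0. z \<in> ball (0::complex) 1"
    by (rule eventually_nhds_in_open) auto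
  ultimately have ev: "\<forall>\<^sub>F z in nhds 0. (g \<circ> f) z = z"
    by eventually_elim (use f in \<open>simp add: class_S_def\<close>)
  have "(g \<circ> f) has_fps_expansion (GG oo FF)"
    unfolding FF_def GG_def by (rule has_fps_expansion_compose[OF G(1) F(1,2)])
  also have "?this \<longleftrightarrow> (\<lambda>z. z) has_fps_expansion (GG oo FF)"
    by (rule has_fps_expansion_cong[OF ev refl])
  finally have X: "GG oo FF = fps_X"
    using has_fps_expansion_fps_X fps_expansion_unique_complex by blast
  show 2: "taylor_coeff g 2 = - taylor_coeff f 2"
    using fps_compose_nth_2[of FF GG] F(2,3) G(2,3)
    by (simp add: X flip: FF_def GG_def) (simp add: eq_neg_iff_add_eq_0 add.commute)
  show "taylor_coeff g 3 = 2 * (taylor_coeff f 2)\<^sup>2 - taylor_coeff f 3"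
    using fps_compose_nth_3[of FF GG] F(2,3) G(2,3) 2
    by (simp add: X flip: FF_def GG_def) (simp add: algebra_simps power2_eq_square)
qed

section \<open>Coefficients of the expressions that define \<open>class_P\<close> and
  \<open>class_L\<close>\<close>

text \<open>Multiplication by f clears both quotients. Since f has a simple zero at 0 with leading
  coefficient 1, the coefficient of order n of Q is read off at order n + 1 of the product, for n =
  0, 1, 2 in turn.\<close>

lemma class_P_coeffs:
  fixes \<alpha> :: real
  assumes f: "f \<in> class_S" and Q: "(\<lambda>z. quot1 f z + complex_of_real \<alpha> * quot2 f z) has_fps_expansion Q"
  shows "fps_nth Q 1 = (1 + 2 * \<alpha>) * taylor_coeff f 2"
    and "fps_nth Q 2 = 2 * (1 + 3 * \<alpha>) * taylor_coeff f 3 - (1 + 2 * \<alpha>) * (taylor_coeff f 2)\<^sup>2"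
proof -
  note F = class_S_fps_expansion[OF f]
  define FF where "FF = fps_expansion f 0"
  have FX: "f has_fps_expansion FF" using F(1) by (simp add: FF_def)
  have "(\<lambda>z. f z * (quot1 f z + complex_of_real \<alpha> * quot2 f z)) has_fps_expansion FF * Q"
    by (intro fps_expansion_intros FX Q)
  also have "?this \<longleftrightarrow> (\<lambda>z. z * deriv f z + complex_of_real \<alpha> * (z ^ 2 * deriv (deriv f) z))
      has_fps_expansion FF * Q"
  proof (rule has_fps_expansion_cong)
    have "\<forall>\<^sub>F z in nhds 0. z \<in> ball (0::complex) 1"
      by (rule eventually_nhds_in_open) auto
    then show "\<forall>\<^sub>F z in nhds 0. f z * (quot1 f z + complex_of_real \<alpha> * quot2 f z) =
        z * deriv f z + complex_of_real \<alpha> * (z ^ 2 * deriv (deriv f) z)"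
    proof eventually_elim
      case (elim z)
      show ?case
        using class_S_nonzero[OF f elim] f
        by (cases "z = 0") (auto simp: class_S_def quot1_def quot2_def field_simps)
    qed
  qed simp
  finally have "FF * Q = fps_X * fps_deriv FF
      + fps_const (complex_of_real \<alpha>) * (fps_X ^ 2 * fps_deriv (fps_deriv FF))"
    by (rule fps_expansion_unique_complex) (intro fps_expansion_intros FX)
  then have eq: "fps_nth (FF * Q) n = fps_nth (fps_X * fps_deriv FF
      + fps_const (complex_of_real \<alpha>) * (fps_X ^ 2 * fps_deriv (fps_deriv FF))) n" for n
    by simp
  have F01: "fps_nth FF 0 = 0" "fps_nth FF (Suc 0) = 1"
    using F(2,3) by (simp_all add: FF_def)
  have 0: "fps_nth Q 0 = 1"
    using eq[of 1] F01 by (simp add: fps_mult_nth fps_X_power_mult_nth)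
  have "fps_nth Q 1 = (1 + 2 * \<alpha>) * fps_nth FF 2"
    using eq[of 2] F01 0
    by (simp add: fps_mult_nth fps_X_power_mult_nth eval_nat_numeral algebra_simps)
  moreover from this have "fps_nth Q 2 = 2 * (1 + 3 * \<alpha>) * fps_nth FF 3 - (1 + 2 * \<alpha>) * (fps_nth FF 2)\<^sup>2"
    using eq[of 3] F01 0
    by (simp add: fps_mult_nth fps_X_power_mult_nth eval_nat_numeral algebra_simps)
  ultimately show "fps_nth Q 1 = (1 + 2 * \<alpha>) * taylor_coeff f 2"
    "fps_nth Q 2 = 2 * (1 + 3 * \<alpha>) * taylor_coeff f 3 - (1 + 2 * \<alpha>) * (taylor_coeff f 2)\<^sup>2"
    by (simp_all add: FF_def)
qed

text \<open>Near 0 the branch is (1 + (p - 1)) to the power c, and p - 1 vanishes at 0, so the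
  binomial series can be composed with \<open>P - 1\<close>.\<close>

lemma power_branch_coeffs:
  assumes h: "power_branch c p h" and P: "p has_fps_expansion P" and p0: "p 0 = 1"
  obtains H where "h has_fps_expansion H" "fps_nth H 0 = 1" "fps_nth H 1 = c * fps_nth P 1"
    "fps_nth H 2 = c * fps_nth P 2 + c * (c - 1) / 2 * (fps_nth P 1)\<^sup>2"
proof -
  let ?H = "fps_binomial (complex_of_real c) oo (P - 1)"
  have P0: "fps_nth (P - 1) 0 = 0"
    using has_fps_expansion_imp_0_eq_fps_nth_0[OF P] p0 by simp
  have "((\<lambda>x. (1 + x) powr complex_of_real c) \<circ> (\<lambda>z. p z - 1)) has_fps_expansion ?H"
    by (rule has_fps_expansion_compose[OF _ _ P0]) (intro fps_expansion_intros P)+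
  also have "?this \<longleftrightarrow> h has_fps_expansion ?H"
    by (rule has_fps_expansion_cong)
       (use h in \<open>auto simp: power_branch_def o_def elim: eventually_mono\<close>)
  finally have "h has_fps_expansion ?H" .
  moreover have "fps_nth ?H 0 = 1"
    by simp
  moreover have "fps_nth ?H 1 = c * fps_nth P 1"
    by (simp only: fps_compose_nth_1) simp
  moreover have "fps_nth ?H 2 = c * fps_nth P 2 + c * (c - 1) / 2 * (fps_nth P 1)\<^sup>2"
    by (simp only: fps_compose_nth_2[OF P0])
       (simp add: gbinomial_prod_rev eval_nat_numeral)
  ultimately show ?thesis
    using that by blast
qed

text \<open>The series P and R of the two bases are found by clearing denominators;
  \<open>power_branch_coeffs\<close> then gives the series U and V of their powers, and Q is the
  product of these.\<close>

lemma class_L_coeffs: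
  fixes \<beta> :: real
  assumes g: "g \<in> class_S" and u: "power_branch \<beta> (quot1 g) u"
    and v: "power_branch (1 - \<beta>) (\<lambda>z. 1 + z * deriv (deriv g) z / deriv g z) v"
    and Q: "(\<lambda>z. u z * v z) has_fps_expansion Q"
  shows "fps_nth Q 1 = (2 - \<beta>) * taylor_coeff g 2"
    and "fps_nth Q 2 = 2 * (3 - 2 * \<beta>) * taylor_coeff g 3
           + (\<beta>\<^sup>2 + 5 * \<beta> - 8) / 2 * (taylor_coeff g 2)\<^sup>2"
proof -
  note G = class_S_fps_expansion[OF g]
  define GG where "GG = fps_expansion g 0"
  have GX: "g has_fps_expansion GG" using G(1) by (simp add: GG_def)
  have G01: "fps_nth GG 0 = 0" "fps_nth GG (Suc 0) = 1"
    using G(2,3) by (simp_all add: GG_def)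
  have GG0: "GG \<noteq> 0" and sd: "subdegree GG = 1"
    using G01 by (auto intro: subdegreeI)
  define P where "P = fps_X * fps_deriv GG / GG"
  \<comment> \<open>Numerator and denominator both vanish to order 1, and the value 1 at 0 is the
    ratio of their leading coefficients.\<close>
  have "(\<lambda>z. if z = 0 then 1 else z * deriv g z / g z) has_fps_expansion P"
    unfolding P_def
  proof (intro has_fps_expansion_divide)
    show "subdegree GG \<le> subdegree (fps_X * fps_deriv GG)"
      unfolding sd using G01 by (intro subdegree_geI) (auto simp: fps_eq_iff intro!: exI[of _ 1])
  qed (intro fps_expansion_intros GX | simp add: GG0 sd G01)+
  then have P: "quot1 g has_fps_expansion P"
    unfolding quot1_def .
  have "P * GG = fps_X * fps_deriv GG"
    unfolding P_def using GG0 sd G01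
    by (intro fps_divide_times_eq fps_times_divide_eq | simp)+
  then have eqP: "fps_nth (P * GG) n = fps_nth (fps_X * fps_deriv GG) n" for n
    by simp
  have P0: "fps_nth P 0 = 1"
    using eqP[of 1] G01 by (simp add: fps_mult_nth)
  have P1: "fps_nth P 1 = fps_nth GG 2"
    using eqP[of 2] G01 P0 by (simp add: fps_mult_nth eval_nat_numeral algebra_simps)
  have P2: "fps_nth P 2 = 2 * fps_nth GG 3 - (fps_nth GG 2)\<^sup>2"
    using eqP[of 3] G01 P0 P1 by (simp add: fps_mult_nth eval_nat_numeral algebra_simps)
  define R where "R = 1 + fps_X * fps_deriv (fps_deriv GG) / fps_deriv GG"
  have R: "(\<lambda>z. 1 + z * deriv (deriv g) z / deriv g z) has_fps_expansion R"
    unfolding R_def by (intro fps_expansion_intros GX) (simp add: G01)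
  have "R * fps_deriv GG = fps_deriv GG + fps_X * fps_deriv (fps_deriv GG)"
    using inverse_mult_eq_1[of "fps_deriv GG"] G01
    by (simp add: R_def fps_divide_unit distrib_right mult.assoc)
  \<comment> \<open>The constant term of \<open>fps_deriv GG\<close> is 1, so the coefficient n of R
    is read off at order n, without the shift by one that P requires.\<close>
  then have eqR: "fps_nth (R * fps_deriv GG) n
      = fps_nth (fps_deriv GG + fps_X * fps_deriv (fps_deriv GG)) n" for n
    by simp
  have R0: "fps_nth R 0 = 1"
    using eqR[of 0] G01 by simp
  have R1: "fps_nth R 1 = 2 * fps_nth GG 2"
    using eqR[of 1] G01 R0 by (simp add: fps_mult_nth eval_nat_numeral algebra_simps)
  have R2: "fps_nth R 2 = 6 * fps_nth GG 3 - 4 * (fps_nth GG 2)\<^sup>2"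
    using eqR[of 2] G01 R0 R1 by (simp add: fps_mult_nth eval_nat_numeral algebra_simps)
  obtain U where U: "u has_fps_expansion U" "fps_nth U 0 = 1" "fps_nth U 1 = \<beta> * fps_nth P 1"
    "fps_nth U 2 = \<beta> * fps_nth P 2 + \<beta> * (\<beta> - 1) / 2 * (fps_nth P 1)\<^sup>2"
    using power_branch_coeffs[OF u P] by (auto simp: quot1_def)
  obtain V where V: "v has_fps_expansion V" "fps_nth V 0 = 1"
    "fps_nth V 1 = (1 - \<beta>) * fps_nth R 1"
    "fps_nth V 2 = (1 - \<beta>) * fps_nth R 2 + (1 - \<beta>) * ((1 - \<beta>) - 1) / 2 * (fps_nth R 1)\<^sup>2"
    using power_branch_coeffs[OF v R] by auto
  have Q: "Q = U * V"
    using Q has_fps_expansion_mult[OF U(1) V(1)] fps_expansion_unique_complex by blast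
  have "fps_nth Q 2 = fps_nth U 2 + fps_nth U 1 * fps_nth V 1 + fps_nth V 2"
    using U(2) V(2) unfolding Q by (simp add: fps_mult_nth eval_nat_numeral)
  \<comment> \<open>The product of the two first-order coefficients cancels against the quadratic
    term of V: both are 2 \<beta> (1 - \<beta>) times the square of the second coefficient of g,
    with opposite signs.\<close>
  also have "\<dots> = 2 * (3 - 2 * \<beta>) * fps_nth GG 3
      + (\<beta>\<^sup>2 + 5 * \<beta> - 8) / 2 * (fps_nth GG 2)\<^sup>2"
    unfolding U V P1 P2 R1 R2 by (simp add: field_simps power2_eq_square)
  finally have "fps_nth Q 2 = 2 * (3 - 2 * \<beta>) * fps_nth GG 3
      + (\<beta>\<^sup>2 + 5 * \<beta> - 8) / 2 * (fps_nth GG 2)\<^sup>2" .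
  moreover have "fps_nth Q 1 = (2 - \<beta>) * fps_nth GG 2"
    using U V P1 R1 unfolding Q by (simp add: fps_mult_nth algebra_simps)
  ultimately show "fps_nth Q 1 = (2 - \<beta>) * taylor_coeff g 2"
    "fps_nth Q 2 = 2 * (3 - 2 * \<beta>) * taylor_coeff g 3
           + (\<beta>\<^sup>2 + 5 * \<beta> - 8) / 2 * (taylor_coeff g 2)\<^sup>2"
    by (simp_all add: GG_def)
qed

section \<open>The bounds on the second and third coefficients\<close>

theorem theorem2p3:
  fixes \<alpha> \<beta> B1 B2 D1 D2 \<sigma> \<Delta> :: real
    and \<phi> \<psi> f g :: "complex \<Rightarrow> complex"
  assumes "\<alpha> \<ge> 0" and "\<beta> \<ge> 0"
    and "\<phi> holomorphic_on unit_disc" and "\<phi> 0 = 1"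
    and "taylor_coeff \<phi> 1 = complex_of_real B1" and "taylor_coeff \<phi> 2 = complex_of_real B2"
    and "B1 > 0"
    and "\<psi> holomorphic_on unit_disc" and "\<psi> 0 = 1"
    and "taylor_coeff \<psi> 1 = complex_of_real D1" and "taylor_coeff \<psi> 2 = complex_of_real D2"
    and "D1 > 0"
    and "bi_univalent f" and "univalent_inverse f g"
    and "f \<in> class_P \<alpha> \<phi>" and "g \<in> class_L \<beta> \<psi>"
    and "\<sigma> = 10 + 36 * \<alpha> - 7 * \<beta> - 25 * \<alpha> * \<beta> + \<beta>\<^sup>2 + 3 * \<alpha> * \<beta>\<^sup>2"
    and "\<Delta> = \<sigma> * B1\<^sup>2 * D1\<^sup>2
             - 2 * (1 + 2 * \<alpha>)\<^sup>2 * (3 - 2 * \<beta>) * (B2 - B1) * D1\<^sup>2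
             - 2 * (2 - \<beta>)\<^sup>2 * (1 + 3 * \<alpha>) * (D2 - D1) * B1\<^sup>2"
  shows "(\<Delta> \<noteq> 0 \<longrightarrow>
            cmod (taylor_coeff f 2) \<le>
              B1 * D1 * sqrt (2 * (B1 * \<bar>3 - 2 * \<beta>\<bar> + D1 * (1 + 3 * \<alpha>))) / sqrt \<bar>\<Delta>\<bar>) \<and>
         cmod (complex_of_real \<sigma> * taylor_coeff f 3) \<le>
           1 / 2 * B1 * \<bar>\<beta>\<^sup>2 - 11 * \<beta> + 16\<bar> + D1 * (1 + 2 * \<alpha>)
           + 1 / 2 * \<bar>\<beta>\<^sup>2 - 11 * \<beta> + 16\<bar> * \<bar>B2 - B1\<bar>
           + (2 - \<beta>)\<^sup>2 * B1\<^sup>2 * \<bar>D2 - D1\<bar> / (D1\<^sup>2 * (1 + 2 * \<alpha>))"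
proof -
  have f: "f \<in> class_S" and g: "g \<in> class_S"
    using assms by (auto simp: class_P_def class_L_def)
  define a b where "a = taylor_coeff f 2" and "b = taylor_coeff f 3"
  have ball: "open (ball (0::complex) 1)" "0 \<in> ball (0::complex) 1" by auto
  have \<Phi>: "\<phi> has_fps_expansion fps_expansion \<phi> 0" and \<Psi>: "\<psi> has_fps_expansion fps_expansion \<psi> 0"
    using assms has_fps_expansion_fps_expansion[OF ball] by blast+
  note B = assms(5,6) and D = assms(10,11)
  let ?q = "\<lambda>z. quot1 f z + complex_of_real \<alpha> * quot2 f z"
  have sub1: "subordinate ?q \<phi>"
    using assms by (simp add: class_P_def)
  then have Q: "?q has_fps_expansion fps_expansion ?q 0"
    using has_fps_expansion_fps_expansion[OF ball] by (simp add: subordinate_def)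
  obtain c x where cx: "cmod c \<le> 1" "cmod x \<le> 1"
    and "taylor_coeff ?q 1 = taylor_coeff \<phi> 1 * c"
      "taylor_coeff ?q 2 = taylor_coeff \<phi> 1 * x + (taylor_coeff \<phi> 2 - taylor_coeff \<phi> 1) * c\<^sup>2"
    by (rule subordinate_coeffs[OF sub1 Q \<Phi>])
  then have e1: "(1 + 2 * \<alpha>) * a = B1 * c"
    and e2: "2 * (1 + 3 * \<alpha>) * b - (1 + 2 * \<alpha>) * a\<^sup>2 = B1 * x + (B2 - B1) * c\<^sup>2"
    by (simp_all only: B class_P_coeffs[OF f Q] a_def b_def of_real_diff)
  obtain u v where u: "power_branch \<beta> (quot1 g) u"
    and v: "power_branch (1 - \<beta>) (\<lambda>z. 1 + z * deriv (deriv g) z / deriv g z) v"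
    and sub2: "subordinate (\<lambda>z. u z * v z) \<psi>"
    using assms by (auto simp: class_L_def)
  then have R: "(\<lambda>z. u z * v z) has_fps_expansion fps_expansion (\<lambda>z. u z * v z) 0"
    using has_fps_expansion_fps_expansion[OF ball] by (simp add: subordinate_def)
  note inv = inverse_taylor_coeffs[OF f g \<open>univalent_inverse f g\<close>]
  obtain d y where dy: "cmod d \<le> 1" "cmod y \<le> 1"
    and "taylor_coeff (\<lambda>z. u z * v z) 1 = taylor_coeff \<psi> 1 * d"
      "taylor_coeff (\<lambda>z. u z * v z) 2
        = taylor_coeff \<psi> 1 * y + (taylor_coeff \<psi> 2 - taylor_coeff \<psi> 1) * d\<^sup>2"
    by (rule subordinate_coeffs[OF sub2 R \<Psi>])
  then have e3: "(2 - \<beta>) * (- a) = D1 * d"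
    and e4: "2 * (3 - 2 * \<beta>) * (2 * a\<^sup>2 - b) + (\<beta>\<^sup>2 + 5 * \<beta> - 8) / 2 * (- a)\<^sup>2
      = D1 * y + (D2 - D1) * d\<^sup>2"
    by (simp_all only: D class_L_coeffs[OF g u v R] inv a_def b_def of_real_diff)
  \<comment> \<open>\<open>M / 2\<close> is the total coefficient of a^2 in e4, namely 4 (3 - 2
    \<beta>) + (\<beta>^2 + 5 \<beta> - 8) / 2.\<close>
  define M where "M = \<beta>\<^sup>2 - 11 * \<beta> + 16"
  have e4': "M / 2 * a\<^sup>2 - 2 * (3 - 2 * \<beta>) * b = D1 * y + (D2 - D1) * d\<^sup>2"
    unfolding e4[symmetric] M_def by (simp add: field_simps)
  have p: "1 + 2 * \<alpha> > 0" "1 + 3 * \<alpha> > 0"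
    using \<open>\<alpha> \<ge> 0\<close> by auto
  \<comment> \<open>Up to sign, \<sigma> is the determinant of the left sides of e2 and e4' as
    linear forms in a^2 and b.\<close>
  have sig: "complex_of_real \<sigma> = (1 + 3 * \<alpha>) * M - 2 * (3 - 2 * \<beta>) * (1 + 2 * \<alpha>)"
    unfolding assms(17) M_def by (simp add: algebra_simps)
  \<comment> \<open>For \<Delta> = 0 the intended bound is infinite, whereas division by 0 in HOL
    would turn its right side into 0.\<close>
  have "\<Delta> \<noteq> 0 \<longrightarrow> cmod a \<le>
              B1 * D1 * sqrt (2 * (B1 * \<bar>3 - 2 * \<beta>\<bar> + D1 * (1 + 3 * \<alpha>))) / sqrt \<bar>\<Delta>\<bar>"
  proof
    assume "\<Delta> \<noteq> 0"
    \<comment> \<open>The weights 3 - 2 \<beta> and 1 + 3 \<alpha> are those for which b cancels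
      between e2 and e4'; the coefficient of a^2 that remains is \<sigma> / 2.\<close>
    let ?S = "complex_of_real (B1 * (3 - 2 * \<beta>)) * x + complex_of_real (D1 * (1 + 3 * \<alpha>)) * y"
    let ?T = "B1 * \<bar>3 - 2 * \<beta>\<bar> + D1 * (1 + 3 * \<alpha>)"
    have x: "B1 * x = 2 * (1 + 3 * \<alpha>) * b - (1 + 2 * \<alpha>) * a\<^sup>2 - (B2 - B1) * c\<^sup>2"
      unfolding e2 by simp
    have y: "D1 * y = M / 2 * a\<^sup>2 - 2 * (3 - 2 * \<beta>) * b - (D2 - D1) * d\<^sup>2"
      unfolding e4' by simp
    have S: "?S = (3 - 2 * \<beta>) * (B1 * x) + (1 + 3 * \<alpha>) * (D1 * y)"
      by (simp add: algebra_simps)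
    have S2: "2 * ?S = \<sigma> * a\<^sup>2 - 2 * (3 - 2 * \<beta>) * ((B2 - B1) * c\<^sup>2)
        - 2 * (1 + 3 * \<alpha>) * ((D2 - D1) * d\<^sup>2)"
      unfolding S x y sig by (simp add: algebra_simps)
    \<comment> \<open>The factor B1^2 D1^2 turns c^2 and d^2 into (B1 c)^2 and (D1 d)^2, which by e1
      and e3 are (1 + 2 \<alpha>)^2 a^2 and (2 - \<beta>)^2 a^2. Everything is then a multiple of
      a^2, and the collected factor is \<Delta>.\<close>
    have "2 * complex_of_real (B1\<^sup>2 * D1\<^sup>2) * ?S = complex_of_real (B1\<^sup>2 * D1\<^sup>2) * (2 * ?S)"
      by simp
    also have "\<dots> = \<sigma> * B1\<^sup>2 * D1\<^sup>2 * a\<^sup>2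
          - 2 * (3 - 2 * \<beta>) * (B2 - B1) * D1\<^sup>2 * (B1 * c)\<^sup>2
          - 2 * (1 + 3 * \<alpha>) * (D2 - D1) * B1\<^sup>2 * (D1 * d)\<^sup>2"
      unfolding S2 unfolding of_real_mult of_real_power by algebra
    also have "\<dots> = \<Delta> * a\<^sup>2"
      unfolding e1[symmetric] e3[symmetric] assms(18) of_real_diff of_real_mult of_real_power
        of_real_add of_real_numeral of_real_1 by algebra
    finally have "2 * complex_of_real (B1\<^sup>2 * D1\<^sup>2) * ?S = \<Delta> * a\<^sup>2" .
    then have "cmod (2 * complex_of_real (B1\<^sup>2 * D1\<^sup>2) * ?S) = cmod (\<Delta> * a\<^sup>2)"
      by (rule arg_cong)
    then have eq: "\<bar>\<Delta>\<bar> * (cmod a)\<^sup>2 = 2 * (B1\<^sup>2 * D1\<^sup>2) * cmod ?S"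
      by (simp only: norm_mult norm_numeral norm_of_real norm_power abs_mult abs_power2)
    have "cmod ?S \<le> \<bar>B1 * (3 - 2 * \<beta>)\<bar> * cmod x + \<bar>D1 * (1 + 3 * \<alpha>)\<bar> * cmod y"
      by (intro norm_triangle_mono) (simp_all only: norm_mult norm_of_real order_refl)
    also have "\<dots> \<le> \<bar>B1 * (3 - 2 * \<beta>)\<bar> * 1 + \<bar>D1 * (1 + 3 * \<alpha>)\<bar> * 1"
      by (intro add_mono mult_left_mono cx dy) auto
    \<comment> \<open>The modulus around 3 - 2 \<beta> has to stay, since this is negative for
      \<beta> > 3/2.\<close>
    also have "\<dots> = ?T"
      using p \<open>B1 > 0\<close> \<open>D1 > 0\<close> by (simp add: abs_mult)
    finally have "cmod ?S \<le> ?T" .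
    then have "2 * (B1\<^sup>2 * D1\<^sup>2) * cmod ?S \<le> 2 * (B1\<^sup>2 * D1\<^sup>2) * ?T"
      by (rule mult_left_mono) simp
    also have "\<dots> = (B1 * D1)\<^sup>2 * (2 * ?T)"
      by (simp add: power_mult_distrib)
    finally have "\<bar>\<Delta>\<bar> * (cmod a)\<^sup>2 \<le> (B1 * D1)\<^sup>2 * (2 * ?T)"
      unfolding eq .
    then have "sqrt (\<bar>\<Delta>\<bar> * (cmod a)\<^sup>2) \<le> sqrt ((B1 * D1)\<^sup>2 * (2 * ?T))"
      by (rule real_sqrt_le_mono)
    then have "sqrt \<bar>\<Delta>\<bar> * cmod a \<le> B1 * D1 * sqrt (2 * ?T)"
      using \<open>B1 > 0\<close> \<open>D1 > 0\<close> by (simp only: real_sqrt_mult real_sqrt_abs) simp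
    then show "cmod a \<le> B1 * D1 * sqrt (2 * ?T) / sqrt \<bar>\<Delta>\<bar>"
      using \<open>\<Delta> \<noteq> 0\<close> by (simp add: pos_le_divide_eq mult.commute)
  qed
  moreover have "cmod (\<sigma> * b) \<le> 1 / 2 * B1 * \<bar>M\<bar> + D1 * (1 + 2 * \<alpha>) + 1 / 2 * \<bar>M\<bar> * \<bar>B2 - B1\<bar>
           + (2 - \<beta>)\<^sup>2 * B1\<^sup>2 * \<bar>D2 - D1\<bar> / (D1\<^sup>2 * (1 + 2 * \<alpha>))"
  proof -
    \<comment> \<open>By e1 and e3 both B1 c and D1 d are multiples of a, which makes (1 + 2
      \<alpha>) d^2 = k c^2. Trading d^2 for c^2 in this way, instead of using |d| <= 1, gives the
      last term of the bound.\<close>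
    define k where "k = (2 - \<beta>)\<^sup>2 * B1\<^sup>2 / (D1\<^sup>2 * (1 + 2 * \<alpha>))"
    have "(1 + 2 * \<alpha>) * (complex_of_real D1 * d)\<^sup>2 * (1 + 2 * \<alpha>) = (2 - \<beta>)\<^sup>2 * (B1 * c)\<^sup>2"
      unfolding e1[symmetric] e3[symmetric] of_real_power by algebra
    moreover have nz: "D1\<^sup>2 * (1 + 2 * \<alpha>) \<noteq> 0"
      using p \<open>D1 > 0\<close> by simp
    then have "k * (D1\<^sup>2 * (1 + 2 * \<alpha>)) = (2 - \<beta>)\<^sup>2 * B1\<^sup>2"
      by (simp add: k_def)
    then have "complex_of_real k * (D1\<^sup>2 * (1 + 2 * \<alpha>)) = (2 - \<beta>)\<^sup>2 * B1\<^sup>2"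
      by (metis of_real_mult)
    ultimately have "complex_of_real (D1\<^sup>2 * (1 + 2 * \<alpha>)) * ((1 + 2 * \<alpha>) * d\<^sup>2)
        = complex_of_real (D1\<^sup>2 * (1 + 2 * \<alpha>)) * (k * c\<^sup>2)"
      unfolding of_real_mult of_real_power by algebra
    then have dk: "(1 + 2 * \<alpha>) * d\<^sup>2 = k * c\<^sup>2"
      using nz by (simp only: mult_cancel_left of_real_eq_0_iff) simp
    have k0: "k \<ge> 0"
      using p by (simp add: k_def)
    \<comment> \<open>Now a^2 is eliminated: the weights \<open>M / 2\<close> and 1 + 2 \<alpha>
      cancel it between e2 and e4', and the coefficient of b is then \<sigma> itself.\<close>
    have "\<sigma> * b = M / 2 * (2 * (1 + 3 * \<alpha>) * b - (1 + 2 * \<alpha>) * a\<^sup>2)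
        + (1 + 2 * \<alpha>) * (M / 2 * a\<^sup>2 - 2 * (3 - 2 * \<beta>) * b)"
      unfolding sig by (simp add: field_simps)
    also have "\<dots> = M / 2 * (B1 * x + (B2 - B1) * c\<^sup>2) + (1 + 2 * \<alpha>) * (D1 * y + (D2 - D1) * d\<^sup>2)"
      unfolding e2 e4' ..
    also have "\<dots> = complex_of_real (1 / 2 * B1 * M) * x + complex_of_real (D1 * (1 + 2 * \<alpha>)) * y
        + complex_of_real (1 / 2 * M * (B2 - B1)) * c\<^sup>2
        + (D2 - D1) * ((1 + 2 * \<alpha>) * d\<^sup>2)"
      by (simp add: field_simps)
    also have "\<dots> = complex_of_real (1 / 2 * B1 * M) * x + complex_of_real (D1 * (1 + 2 * \<alpha>)) * y
        + complex_of_real (1 / 2 * M * (B2 - B1)) * c\<^sup>2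
        + complex_of_real ((D2 - D1) * k) * c\<^sup>2"
      unfolding dk by (simp add: mult.assoc)
    also have "cmod \<dots> \<le> \<bar>1 / 2 * B1 * M\<bar> * cmod x + \<bar>D1 * (1 + 2 * \<alpha>)\<bar> * cmod y
        + \<bar>1 / 2 * M * (B2 - B1)\<bar> * (cmod c)\<^sup>2 + \<bar>(D2 - D1) * k\<bar> * (cmod c)\<^sup>2"
      by (intro norm_triangle_mono) (simp_all only: norm_mult norm_of_real norm_power order_refl)
    also have "\<dots> \<le> \<bar>1 / 2 * B1 * M\<bar> * 1 + \<bar>D1 * (1 + 2 * \<alpha>)\<bar> * 1
        + \<bar>1 / 2 * M * (B2 - B1)\<bar> * 1 + \<bar>(D2 - D1) * k\<bar> * 1"
      by (intro add_mono mult_left_mono cx dy) (auto simp: power_le_one cx)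
    \<comment> \<open>M keeps its modulus because it is negative between its two positive roots in
      \<beta>.\<close>
    also have "\<dots> = 1 / 2 * B1 * \<bar>M\<bar> + D1 * (1 + 2 * \<alpha>) + 1 / 2 * \<bar>M\<bar> * \<bar>B2 - B1\<bar> + \<bar>D2 - D1\<bar> * k"
      using p k0 \<open>B1 > 0\<close> \<open>D1 > 0\<close> by (simp add: abs_mult)
    finally show ?thesis
      by (simp add: k_def mult_ac)
  qed
  ultimately show ?thesis
    unfolding a_def b_def M_def by blast
qed

end
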